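(* Consider the well-balanced (modified) finite volume method for the system of hyperbolic balance laws $\partial_t \mathbf q+\nabla\cdot\mathcal F(\mathbf q)=\mathbf s(\mathbf q,\mathbf x,t)$ with target solution $\tilde{\mathbf q}$ on a mesh of control volumes $\Omega_1,\dots,\Omega_N$, i.e. the semi-discrete scheme that evolves the deviations $\Delta\mathbf Q_i(t)$, $i\in\{1,\dots,N\}$, by $$ \frac{d}{dt}(\Delta\mathbf Q_i(t))=-\frac1{V_i}\sum_{k\in N(i)}\sum_{j=1}^{M}\omega_j\,\Delta\hat{\mathcal F}\big(\Delta\mathbf Q_i^{\mathrm{rec}}(\mathbf x_{ikj},t),\Delta\mathbf Q_k^{\mathrm{rec}}(\mathbf x_{ikj},t),\tilde{\mathbf q}(\mathbf x_{ikj},t),\mathbf n(\mathbf x_{ikj})\big) $$ $$ \qquad+\frac1{V_i}I_{\mathbf x\in\Omega_i}\big[\mathbf s((\Delta\mathbf Q_i^{\mathrm{rec}}+\tilde{\mathbf q})(\mathbf x,t),\mathbf x,t)\big]-\frac1{V_i}I_{\mathbf x\in\Omega_i}\big[\mathbf s(\tilde{\mathbf q}(\mathbf x,t),\mathbf x,t)\big], $$ with all ingredients as defined in the context. This method satisfies the following property: if $$\Delta\mathbf Q_i=0\qquad\text{for all } i\in\{1,\dots,N\}$$ at initial time, then this holds for all $t>0$. Consequently, if the initial condition $\mathbf Q_i(t=0)$, $i=1,\dots,N$, equals the cell averages of the target solution $\tilde{\mathbf Q}_i(t=0)$, $i=1,\dots,N$, then the computed solution equals the target solution for all time (in terms of the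 cell averages: $\mathbf Q_i(t)=\tilde{\mathbf Q}_i(t)$ for all $i$ and all $t>0$).
   Context: Balance law. Consider a system of hyperbolic balance laws in three space dimensions, $\partial_t\mathbf q(\mathbf x,t)+\nabla\cdot\mathcal F(\mathbf q(\mathbf x,t))=\mathbf s(\mathbf q(\mathbf x,t),\mathbf x,t)$, where $\mathbf q$ is the vector of conserved variables, $\mathcal F=(\mathbf f_1,\mathbf f_2,\mathbf f_3)$ with $\mathbf f_l$ the flux in direction $l$, and $\mathbf s$ is the source term. For $\mathbf n=(n_1,n_2,n_3)$ write $\mathbf n\cdot\mathcal F=\sum_l n_l\mathbf f_l$. Target solution. $\tilde{\mathbf q}(\mathbf x,t)$ is a given, continuous and sufficiently smooth solution of the balance law (it may depend on time). Mesh. The spatial domain is partitioned into non-overlapping control volumes $\Omega_1,\dots,\Omega_N$ with volumes $V_i=|\Omega_i|$. $N(i)$ is the set of indices of all control volumes sharing an interface with $\Omega_i$, $\partial\Omega_{ik}$ is the interface between $\Omega_i$ and $\Omega_k$, $\mathbf n$ is the outward unit normal of $\Omega_i$ on $\partial\Omega_{ik}$, and $\mathbf x_{ikj}$, $j=1,\dots,M$, are the quadrature points at the interface $\partial\Omega_{ik}$ with corresponding weights $\omega_j$. Boundary conditions are not considered: the flux contributions are exactly those from interfaces $\partial\Omega_{ik}$, $k\in N(i)$. Averages and deviations. $\tilde{\mathbf Q}_i(t)=\frac1{V_i}\int_{\Omega_i}\tilde{\mathbf q}(\mathbf x,t)\,d\mathbf x$ is the cell average of the target solution. $\mathbf Q_i(t)$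 denotes the computed cell-average values, and $\Delta\mathbf Q_i:=\mathbf Q_i-\tilde{\mathbf Q}_i$. The computed solution is thus $\mathbf Q_i=\tilde{\mathbf Q}_i+\Delta\mathbf Q_i$, with $\Delta\mathbf Q_i$ evolved in time by the scheme displayed in the claim from the given initial data. Reconstruction. The reconstructed functions $\Delta\mathbf Q_i^{\mathrm{rec}}$ are obtained by applying a consistent conservative reconstruction routine to the cell-average values $\Delta\mathbf Q$. Conservative means that the average of $\Delta\mathbf Q_i^{\mathrm{rec}}(\cdot,t)$ over $\Omega_i$ is $\Delta\mathbf Q_i(t)$; consistency includes that, if all cell values $\Delta\mathbf Q_i$ are zero, then every reconstructed function $\Delta\mathbf Q_i^{\mathrm{rec}}$ is identically zero. Numerical flux. $\mathbf F(\cdot,\cdot,\mathbf n)$ is a numerical flux function consistent with $\mathbf n\cdot\mathcal F$: it is Lipschitz continuous in its first two arguments and $\mathbf F(\mathbf q,\mathbf q,\mathbf n)=\mathbf n\cdot\mathcal F(\mathbf q)$ for all unit vectors $\mathbf n$. The numerical flux difference is $$\Delta\hat{\mathcal F}(\Delta\mathbf Q^L,\Delta\mathbf Q^R,\tilde{\mathbf q},\mathbf n):=\mathbf F(\Delta\mathbf Q^L+\tilde{\mathbf q},\Delta\mathbf Q^R+\tilde{\mathbf q},\mathbf n)-\mathbf n\cdot\mathcal F(\tilde{\mathbf q}).$$ Source discretization. $I_{\mathbf x\in\Omega_i}[\psi]$ denotes a consistent discretization of the integral $\int_{\Omega_i}\psi(\mathbf x)\,d\mathbf x$; the same discretization is used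 in both source terms of the scheme.
   Formalization: It is additionally assumed that the semi-discrete scheme has at most one solution for the given initial data; without this the claim fails, e.g. zero flux, s(q)=2√|q|, target 0, where ΔQ(t)=t² solves the scheme from zero data. *)

theory Defs
  imports "HOL-Analysis.Analysis"
begin

section \<open>Balance laws in three space dimensions\<close>

text \<open>
  The states are vectors of type \<^typ>\<open>real ^ 'm\<close>, with an arbitrary number of conserved
  variables. The set \<open>S\<close> contains the states for which the balance law is posed (the whole space,
  or for instance the states with positive density).
\<close>

type_synonym space = "real ^ 3"

type_synonym 'm flux = "3 \<Rightarrow> real ^ 'm \<Rightarrow> real ^ 'm"

type_synonym 'm source = "real ^ 'm \<Rightarrow> space \<Rightarrow> real \<Rightarrow> real ^ 'm"

definition normal_flux :: "'m flux \<Rightarrow> space \<Rightarrow> real ^ 'm \<Rightarrow> real ^ 'm" where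
  "normal_flux f n q = (\<Sum>l\<in>UNIV. (n $ l) *\<^sub>R f l q)"

definition real_diagonalizable :: "real ^ 'm ^ 'm \<Rightarrow> bool" where
  "real_diagonalizable A \<longleftrightarrow>
    (\<exists>P D :: real ^ 'm ^ 'm. invertible P \<and> (\<forall>i j. i \<noteq> j \<longrightarrow> D $ i $ j = 0) \<and> A ** P = P ** D)"

definition hyperbolic_on :: "(real ^ 'm) set \<Rightarrow> 'm flux \<Rightarrow> bool" where
  "hyperbolic_on S f \<longleftrightarrow>
    open S \<and>
    (\<forall>q\<in>S. \<forall>l. f l differentiable (at q)) \<and>
    (\<forall>q\<in>S. \<forall>n::space. norm n = 1 \<longrightarrow>
      real_diagonalizable (\<Sum>l\<in>UNIV. (n $ l) *\<^sub>R jacobian (f l) (at q)))"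

definition flux_divergence :: "'m flux \<Rightarrow> (space \<Rightarrow> real ^ 'm) \<Rightarrow> space \<Rightarrow> real ^ 'm" where
  "flux_divergence f q x = (\<Sum>l\<in>UNIV. frechet_derivative (\<lambda>y. f l (q y)) (at x) (axis l 1))"

text \<open>
  A solution is continuous up to the boundary of \<open>D\<close> and up to the initial time, and is
  continuously differentiable, with the equation satisfied pointwise, in the interior.
\<close>

definition classical_solution ::
  "(real ^ 'm) set \<Rightarrow> 'm flux \<Rightarrow> 'm source \<Rightarrow> space set \<Rightarrow> (space \<Rightarrow> real \<Rightarrow> real ^ 'm) \<Rightarrow> bool" where
  "classical_solution S f s D q \<longleftrightarrow>
    (\<forall>x\<in>D. \<forall>t\<ge>0. q x t \<in> S) \<and>
    continuous_on (D \<times> {0..}) (\<lambda>(x, t). q x t) \<and>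
    (\<exists>q' :: space \<times> real \<Rightarrow> (space \<times> real) \<Rightarrow>\<^sub>L (real ^ 'm).
      continuous_on (interior D \<times> {0<..}) q' \<and>
      (\<forall>p\<in>interior D \<times> {0<..}. ((\<lambda>(x, t). q x t) has_derivative blinfun_apply (q' p)) (at p))) \<and>
    (\<forall>x\<in>interior D. \<forall>t>0.
      vector_derivative (q x) (at t) + flux_divergence f (\<lambda>y. q y t) x = s (q x t) x t)"


section \<open>Meshes\<close>

text \<open>
  The control volumes are indexed by a finite type \<open>'c\<close>, whose cardinality is the number of cells.
  They are taken closed, so that an interface is contained in both adjacent cells.
\<close>

definition is_mesh :: "('c::finite \<Rightarrow> space set) \<Rightarrow> bool" where
  "is_mesh \<Omega> \<longleftrightarrow>
    (\<forall>i. compact (\<Omega> i) \<and> measure lebesgue (\<Omega> i) > 0) \<and>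
    (\<forall>i k. i \<noteq> k \<longrightarrow> negligible (\<Omega> i \<inter> \<Omega> k))"

text \<open>
  Near a regular interface point, the cells \<open>A\<close> and \<open>B\<close> are the two sides of a regular \<open>C\<^sup>1\<close>
  surface. This excludes cells meeting only along an edge, at a vertex or tangentially, and allows
  curved interfaces and hanging nodes. The normal \<open>n\<close> points out of \<open>A\<close>.
\<close>

definition regular_interface_point :: "space set \<Rightarrow> space set \<Rightarrow> space \<Rightarrow> space \<Rightarrow> bool" where
  "regular_interface_point A B x n \<longleftrightarrow>
    x \<in> A \<inter> B \<and>
    (\<exists>U \<phi> g. open U \<and> x \<in> U \<and>
      (\<forall>y\<in>U. GDERIV \<phi> y :> g y) \<and> continuous_on U g \<and> g x \<noteq> 0 \<and>
      A \<inter> U = {y\<in>U. \<phi> y \<le> 0} \<and> B \<inter> U = {y\<in>U. \<phi> y \<ge> 0} \<and>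
      n = g x /\<^sub>R norm (g x))"

definition interface :: "space set \<Rightarrow> space set \<Rightarrow> space set" where
  "interface A B = closure {x. \<exists>n. regular_interface_point A B x n}"

text \<open>
  Quadrature points may lie on the rim of an interface, where the normal is the limit of the normals
  at regular points.
\<close>

definition outward_unit_normal :: "space set \<Rightarrow> space set \<Rightarrow> space \<Rightarrow> space \<Rightarrow> bool" where
  "outward_unit_normal A B x n \<longleftrightarrow>
    (\<exists>y \<nu>. (\<forall>m::nat. regular_interface_point A B (y m) (\<nu> m)) \<and> y \<longlonglongrightarrow> x \<and> \<nu> \<longlonglongrightarrow> n)"

definition neighbours :: "('c \<Rightarrow> space set) \<Rightarrow> 'c \<Rightarrow> 'c set" where
  "neighbours \<Omega> i = {k. k \<noteq> i \<and> interface (\<Omega> i) (\<Omega> k) \<noteq> {}}"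

definition cell_average :: "space set \<Rightarrow> (space \<Rightarrow> real ^ 'm) \<Rightarrow> real ^ 'm" where
  "cell_average A q = (1 / measure lebesgue A) *\<^sub>R integral A q"


section \<open>Ingredients of the scheme\<close>

text \<open>
  A reconstruction routine maps the family of all cell values to one function per cell; only the
  values of the \<open>i\<close>-th function on the \<open>i\<close>-th cell matter.
\<close>

type_synonym ('c, 'm) reconstruction = "('c \<Rightarrow> real ^ 'm) \<Rightarrow> 'c \<Rightarrow> space \<Rightarrow> real ^ 'm"

definition conservative_reconstruction ::
  "('c \<Rightarrow> space set) \<Rightarrow> ('c, 'm::finite) reconstruction \<Rightarrow> bool" where
  "conservative_reconstruction \<Omega> rec \<longleftrightarrow>
    (\<forall>Q i. rec Q i absolutely_integrable_on \<Omega> i \<and> cell_average (\<Omega> i) (rec Q i) = Q i)"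

definition consistent_reconstruction ::
  "('c \<Rightarrow> space set) \<Rightarrow> ('c, 'm::finite) reconstruction \<Rightarrow> bool" where
  "consistent_reconstruction \<Omega> rec \<longleftrightarrow>
    (\<forall>Q. (\<forall>i. Q i = 0) \<longrightarrow> (\<forall>i. \<forall>x\<in>\<Omega> i. rec Q i x = 0))"

type_synonym 'm numerical_flux = "real ^ 'm \<Rightarrow> real ^ 'm \<Rightarrow> space \<Rightarrow> real ^ 'm"

text \<open>
  Lipschitz continuity is required on compact sets of states: the normal flux itself, hence every
  consistent numerical flux, fails to be globally Lipschitz already for quadratic fluxes.
\<close>

definition consistent_numerical_flux ::
  "(real ^ 'm) set \<Rightarrow> 'm flux \<Rightarrow> 'm numerical_flux \<Rightarrow> bool" where
  "consistent_numerical_flux S f F \<longleftrightarrow>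
    (\<forall>n. norm n = 1 \<longrightarrow>
      (\<forall>K. compact K \<and> K \<subseteq> S \<longrightarrow> (\<exists>L. L-lipschitz_on (K \<times> K) (\<lambda>(a, b). F a b n))) \<and>
      (\<forall>q\<in>S. F q q n = normal_flux f n q))"

text \<open>
  On a fixed mesh, a consistent discretization of the integral over \<open>A\<close> uses only the values of the
  integrand on \<open>A\<close> and is exact for constants. Neither linearity nor a particular quadrature formula
  is prescribed.
\<close>

definition consistent_integral_discretization ::
  "space set \<Rightarrow> ((space \<Rightarrow> real ^ 'm) \<Rightarrow> real ^ 'm) \<Rightarrow> bool" where
  "consistent_integral_discretization A J \<longleftrightarrow>
    (\<forall>\<psi> \<psi>'. (\<forall>x\<in>A. \<psi> x = \<psi>' x) \<longrightarrow> J \<psi> = J \<psi>') \<and>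
    (\<forall>c. J (\<lambda>_. c) = measure lebesgue A *\<^sub>R c)"


section \<open>The well-balanced semi-discrete scheme\<close>

definition flux_difference ::
  "'m flux \<Rightarrow> 'm numerical_flux \<Rightarrow> real ^ 'm \<Rightarrow> real ^ 'm \<Rightarrow> real ^ 'm \<Rightarrow> space \<Rightarrow> real ^ 'm" where
  "flux_difference f F dL dR q n = F (dL + q) (dR + q) n - normal_flux f n q"

text \<open>
  \<open>xq i k j\<close> and \<open>w j\<close> are the quadrature points and weights, \<open>nv i k\<close> is the normal field on the
  interface of the cells \<open>i\<close> and \<open>k\<close>, and \<open>J i\<close> discretizes the integral over the cell \<open>i\<close>.
\<close>

definition scheme_rhs ::
  "('c \<Rightarrow> space set) \<Rightarrow> nat \<Rightarrow> ('c \<Rightarrow> 'c \<Rightarrow> nat \<Rightarrow> space) \<Rightarrow> (nat \<Rightarrow> real) \<Rightarrow>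
   ('c \<Rightarrow> 'c \<Rightarrow> space \<Rightarrow> space) \<Rightarrow> 'm flux \<Rightarrow> 'm source \<Rightarrow> 'm numerical_flux \<Rightarrow>
   ('c, 'm) reconstruction \<Rightarrow> ('c \<Rightarrow> (space \<Rightarrow> real ^ 'm) \<Rightarrow> real ^ 'm) \<Rightarrow>
   (space \<Rightarrow> real \<Rightarrow> real ^ 'm) \<Rightarrow> real \<Rightarrow> ('c \<Rightarrow> real ^ 'm) \<Rightarrow> 'c \<Rightarrow> real ^ 'm" where
  "scheme_rhs \<Omega> M xq w nv f s F rec J q t dQ i =
    - (1 / measure lebesgue (\<Omega> i)) *\<^sub>R
        (\<Sum>k\<in>neighbours \<Omega> i. \<Sum>j=1..M. w j *\<^sub>R
          flux_difference f F (rec dQ i (xq i k j)) (rec dQ k (xq i k j))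
            (q (xq i k j) t) (nv i k (xq i k j)))
    + (1 / measure lebesgue (\<Omega> i)) *\<^sub>R J i (\<lambda>x. s (rec dQ i x + q x t) x t)
    - (1 / measure lebesgue (\<Omega> i)) *\<^sub>R J i (\<lambda>x. s (q x t) x t)"

text \<open>The derivative at the initial time is one-sided.\<close>

definition evolves_by ::
  "(real \<Rightarrow> ('c \<Rightarrow> real ^ 'm) \<Rightarrow> 'c \<Rightarrow> real ^ 'm) \<Rightarrow> (real \<Rightarrow> 'c \<Rightarrow> real ^ 'm) \<Rightarrow> bool" where
  "evolves_by rhs dQ \<longleftrightarrow>
    (\<forall>t\<ge>0. \<forall>i. ((\<lambda>\<tau>. dQ \<tau> i) has_vector_derivative rhs t (dQ t) i) (at t within {0..}))"

end

theory Submission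
  imports Defs
begin

text \<open>
  The right-hand side of the scheme is a difference of two discretizations of the same terms, one at
  the reconstructed state and one at the target solution. For zero deviations the reconstruction
  vanishes on each cell, so both are evaluated at the same state: the source terms cancel since \<open>J i\<close>
  depends only on the values in its cell, and the fluxes cancel by consistency of the numerical flux
  (\<open>flux_difference_zero\<close>). Hence the constant zero family is a stationary solution of the scheme
  (\<open>evolves_by_zero\<close>). Since the evolution is determined by its initial data, every evolution that
  starts at zero is this one. The statement about cell averages is the same fact for
  \<open>Q - Qt\<close>.

  Consistency of the numerical flux is available only for unit normals and for states in \<open>S\<close>. The
  geometric content of the proof is therefore that quadrature points belong to both adjacent cells
  (\<open>interface_subset_cells\<close>), where the target takes values in \<open>S\<close> and both reconstructions
  vanish, and that normals have length one also on the rim of an interface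
  (\<open>norm_outward_unit_normal\<close>).
\<close>

text \<open>Closed cells contain the limits of their common regular points.\<close>

lemma interface_subset_cells:
  assumes "closed A" "closed B"
  shows "interface A B \<subseteq> A \<inter> B"
  unfolding interface_def
  by (rule closure_minimal) (use assms in \<open>auto simp: regular_interface_point_def\<close>)

text \<open>
  At a regular point the normal is a normalized non-zero gradient; having norm one is preserved in
  the limit that defines the normal on the rim.
\<close>

lemma norm_outward_unit_normal:
  assumes "outward_unit_normal A B x n"
  shows "norm n = 1"
proof -
  obtain y \<nu> where reg: "\<And>m::nat. regular_interface_point A B (y m) (\<nu> m)"
    and lim: "\<nu> \<longlonglongrightarrow> n"
    using assms by (auto simp: outward_unit_normal_def)
  have "norm (\<nu> m) = 1" for m
    using reg[of m] by (auto simp: regular_interface_point_def)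
  then have "(\<lambda>_::nat. 1) \<longlonglongrightarrow> norm n"
    using tendsto_norm[OF lim] by simp
  then show ?thesis
    by (simp add: LIMSEQ_const_iff)
qed

lemma flux_difference_zero:
  assumes "consistent_numerical_flux S f F" "norm n = 1" "q \<in> S"
  shows "flux_difference f F 0 0 q n = 0"
  using assms by (simp add: flux_difference_def consistent_numerical_flux_def)

lemma scheme_rhs_zero:
  fixes \<Omega> :: "'c::finite \<Rightarrow> space set"
    and rec :: "('c, 'm::finite) reconstruction"
  assumes closed: "\<And>i. closed (\<Omega> i)"
    and states: "\<And>i x. x \<in> \<Omega> i \<Longrightarrow> q x t \<in> S"
    and points:
      "\<And>i k j. \<lbrakk>k \<in> neighbours \<Omega> i; j \<in> {1..M}\<rbrakk> \<Longrightarrow> xq i k j \<in> interface (\<Omega> i) (\<Omega> k)"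
    and normals:
      "\<And>i k x. \<lbrakk>k \<in> neighbours \<Omega> i; x \<in> interface (\<Omega> i) (\<Omega> k)\<rbrakk>
        \<Longrightarrow> outward_unit_normal (\<Omega> i) (\<Omega> k) x (nv i k x)"
    and rec: "consistent_reconstruction \<Omega> rec"
    and flux: "consistent_numerical_flux S f F"
    and source: "\<And>i. consistent_integral_discretization (\<Omega> i) (J i)"
  shows "scheme_rhs \<Omega> M xq w nv f s F rec J q t (\<lambda>_. 0) i = 0"
proof -
  have rec0: "rec (\<lambda>_. 0) k x = 0" if "x \<in> \<Omega> k" for k x
    using rec that by (simp add: consistent_reconstruction_def)
  have "flux_difference f F (rec (\<lambda>_. 0) i (xq i k j)) (rec (\<lambda>_. 0) k (xq i k j))
          (q (xq i k j) t) (nv i k (xq i k j)) = 0"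
    if k: "k \<in> neighbours \<Omega> i" and j: "j \<in> {1..M}" for k j
  proof -
    have "xq i k j \<in> \<Omega> i" "xq i k j \<in> \<Omega> k"
      using interface_subset_cells[OF closed closed] points[OF k j] by blast+
    moreover have "norm (nv i k (xq i k j)) = 1"
      using normals[OF k points[OF k j]] by (rule norm_outward_unit_normal)
    ultimately show ?thesis
      using flux_difference_zero[OF flux] states rec0 by simp
  qed
  moreover have "J i (\<lambda>x. s (rec (\<lambda>_. 0) i x + q x t) x t) = J i (\<lambda>x. s (q x t) x t)"
  proof -
    \<comment> \<open>The reconstruction vanishes only on its own cell, so the two integrands may differ elsewhere.\<close>
    have agree: "\<forall>x\<in>\<Omega> i. s (rec (\<lambda>_. 0) i x + q x t) x t = s (q x t) x t"
      by (simp add: rec0)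
    have "\<forall>\<psi> \<psi>'. (\<forall>x\<in>\<Omega> i. \<psi> x = \<psi>' x) \<longrightarrow> J i \<psi> = J i \<psi>'"
      using source[of i] by (simp add: consistent_integral_discretization_def)
    from this[rule_format, OF agree[rule_format]] show ?thesis .
  qed
  ultimately show ?thesis
    by (simp add: scheme_rhs_def)
qed

lemma evolves_by_zero:
  assumes "\<And>t i. t \<ge> 0 \<Longrightarrow> rhs t (\<lambda>_. 0) i = 0"
  shows "evolves_by rhs (\<lambda>_ _. 0)"
  using assms by (simp add: evolves_by_def)

theorem theorem4p1:
  fixes S :: "(real ^ 'm) set"
    and f :: "'m flux"
    and s :: "'m source"
    and qt :: "space \<Rightarrow> real \<Rightarrow> real ^ 'm"
    and \<Omega> :: "'c::finite \<Rightarrow> space set"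
    and M :: nat
    and xq :: "'c \<Rightarrow> 'c \<Rightarrow> nat \<Rightarrow> space"
    and w :: "nat \<Rightarrow> real"
    and nv :: "'c \<Rightarrow> 'c \<Rightarrow> space \<Rightarrow> space"
    and rec :: "('c, 'm) reconstruction"
    and F :: "'m numerical_flux"
    and J :: "'c \<Rightarrow> (space \<Rightarrow> real ^ 'm) \<Rightarrow> real ^ 'm"
    and Q Qt dQ :: "real \<Rightarrow> 'c \<Rightarrow> real ^ 'm"
    and rhs :: "real \<Rightarrow> ('c \<Rightarrow> real ^ 'm) \<Rightarrow> 'c \<Rightarrow> real ^ 'm"
  assumes hyperbolic: "hyperbolic_on S f"
    and mesh: "is_mesh \<Omega>"
    and target: "classical_solution S f s (\<Union>i. \<Omega> i) qt"
    and quadrature_points: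
      "\<And>i k j. \<lbrakk>k \<in> neighbours \<Omega> i; j \<in> {1..M}\<rbrakk> \<Longrightarrow> xq i k j \<in> interface (\<Omega> i) (\<Omega> k)"
    and normals:
      "\<And>i k x. \<lbrakk>k \<in> neighbours \<Omega> i; x \<in> interface (\<Omega> i) (\<Omega> k)\<rbrakk>
        \<Longrightarrow> outward_unit_normal (\<Omega> i) (\<Omega> k) x (nv i k x)"
    and reconstruction: "conservative_reconstruction \<Omega> rec" "consistent_reconstruction \<Omega> rec"
    and numerical_flux: "consistent_numerical_flux S f F"
    and source_discretization: "\<And>i. consistent_integral_discretization (\<Omega> i) (J i)"
    and target_averages: "\<And>t i. t \<ge> 0 \<Longrightarrow> Qt t i = cell_average (\<Omega> i) (\<lambda>x. qt x t)"
    and computed_solution: "\<And>t i. t \<ge> 0 \<Longrightarrow> Q t i = Qt t i + dQ t i"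
    and rhs: "rhs = scheme_rhs \<Omega> M xq w nv f s F rec J qt"
    and scheme: "evolves_by rhs dQ"
    and determined_by_initial_data:
      "\<And>P. \<lbrakk>evolves_by rhs P; \<forall>i. P 0 i = dQ 0 i\<rbrakk> \<Longrightarrow> \<forall>t\<ge>0. \<forall>i. P t i = dQ t i"
  shows "((\<forall>i. dQ 0 i = 0) \<longrightarrow> (\<forall>t>0. \<forall>i. dQ t i = 0)) \<and>
         ((\<forall>i. Q 0 i = Qt 0 i) \<longrightarrow> (\<forall>t>0. \<forall>i. Q t i = Qt t i))"
proof -
  have closed: "closed (\<Omega> i)" for i
    using mesh by (simp add: is_mesh_def compact_imp_closed)
  have states: "qt x t \<in> S" if "t \<ge> 0" "x \<in> \<Omega> i" for t i x
    using target that by (auto simp: classical_solution_def)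
  have "rhs t (\<lambda>_. 0) i = 0" if "t \<ge> 0" for t i
    unfolding rhs
    using closed states[OF that] quadrature_points normals
      reconstruction(2) numerical_flux source_discretization
    by (rule scheme_rhs_zero[where \<Omega> = \<Omega> and q = qt and S = S and xq = xq and nv = nv
          and J = J and M = M])
  then have zero: "evolves_by rhs (\<lambda>_ _. 0)"
    by (rule evolves_by_zero)
  have deviations: "\<forall>t\<ge>0. \<forall>i. dQ t i = 0" if "\<forall>i. dQ 0 i = 0"
  proof -
    have "\<forall>t\<ge>0. \<forall>i. 0 = dQ t i"
      by (rule determined_by_initial_data[OF zero]) (simp add: that)
    then show ?thesis
      by simp
  qed
  have averages: "\<forall>t>0. \<forall>i. Q t i = Qt t i" if Q0: "\<forall>i. Q 0 i = Qt 0 i"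
  proof (intro allI impI)
    fix t :: real and i
    assume t: "t > 0"
    have "dQ 0 k = 0" for k
      using Q0[rule_format, of k] computed_solution[of 0 k] by simp
    then have "dQ t i = 0"
      using deviations t by simp
    then show "Q t i = Qt t i"
      using computed_solution[of t i] t by simp
  qed
  show ?thesis
    using averages deviations by (intro conjI impI) simp_all
qed

end
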